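(* Let $n\ge 1$ and let $f,g,h\in C_0(\mathbb{R}^n)$. Then $$\|f\|_1\,\|g\star_0\bar h\|_1\le 2^n\,\|f\star_0\bar g\|_1\,\|f\star_0\bar h\|_1 .$$ Moreover, the constant is sharp, i.e. for each $n$ the constant $2^n$ cannot be replaced by a smaller one in this inequality (for all $f,g,h\in C_0(\mathbb{R}^n)$).
   Context: $C_0(\mathbb{R}^n)$ is the set of upper semicontinuous log-concave functions $f:\mathbb{R}^n\to[0,\infty)$ (i.e. $f(\lambda x+(1-\lambda)y)\ge f(x)^\lambda f(y)^{1-\lambda}$ for all $x,y$ with $f(x),f(y)>0$ and $\lambda\in[0,1]$) with $\|f\|_\infty=f(0)=1$ and $\lim_{|x|\to\infty}f(x)=0$. The Asplund product is $(f\star_0 g)(x)=\sup_{y+z=x}f(y)g(z)$. $\bar g(x)=g(-x)$. $\|f\|_1=\int_{\mathbb{R}^n}f(x)\,dx$ for $f\ge0$. *)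

theory Defs
  imports "HOL-Analysis.Analysis"
begin

definition upper_semicontinuous :: "('a::topological_space \<Rightarrow> real) \<Rightarrow> bool" where
  "upper_semicontinuous f \<longleftrightarrow> (\<forall>x c. f x < c \<longrightarrow> (\<forall>\<^sub>F y in nhds x. f y < c))"

(* The inequality is only required at points where f is positive: 0 powr 0 = 0 in HOL,
   so these guards are also what makes the endpoints t = 0 and t = 1 harmless. *)
definition log_concave :: "('a::real_vector \<Rightarrow> real) \<Rightarrow> bool" where
  "log_concave f \<longleftrightarrow>
     (\<forall>x y t. 0 < f x \<and> 0 < f y \<and> 0 \<le> t \<and> t \<le> 1 \<longrightarrow>
        f x powr t * f y powr (1 - t) \<le> f (t *\<^sub>R x + (1 - t) *\<^sub>R y))"

(* Pointwise supremum, not essential supremum: the indicator of the origin belongs to C_0.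
   The value is taken in ennreal so that unbounded functions have norm \<infinity>. *)
definition sup_norm :: "('a \<Rightarrow> real) \<Rightarrow> ennreal" where
  "sup_norm f = (SUP x. ennreal \<bar>f x\<bar>)"

definition C_0 :: "('a::real_normed_vector \<Rightarrow> real) set" where
  "C_0 = {f. (\<forall>x. 0 \<le> f x) \<and> upper_semicontinuous f \<and> log_concave f \<and>
             sup_norm f = ennreal (f 0) \<and> f 0 = 1 \<and> (f \<longlongrightarrow> 0) at_infinity}"

(* A real supremum, meaningful when the products are bounded above; for f, g in C_0
   they lie in [0, 1]. *)
definition asplund :: "('a::ab_group_add \<Rightarrow> real) \<Rightarrow> ('a \<Rightarrow> real) \<Rightarrow> 'a \<Rightarrow> real"
    (infixl "\<star>\<^sub>0" 70) where
  "(f \<star>\<^sub>0 g) x = (SUP (y, z) \<in> {(y, z). y + z = x}. f y * g z)"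

definition reflect :: "('a::ab_group_add \<Rightarrow> real) \<Rightarrow> 'a \<Rightarrow> real" where
  "reflect g x = g (- x)"

(* Used for nonnegative functions only (ennreal truncates negative values to 0). *)
definition L1_norm :: "('a::euclidean_space \<Rightarrow> real) \<Rightarrow> ennreal" where
  "L1_norm f = (\<integral>\<^sup>+x. ennreal (f x) \<partial>lborel)"

end

theory Submission
  imports Defs
begin

text \<open>
  The inequality is a functional version of Ruzsa's triangle inequality
  \<open>|A| |B - C| \<le> |A - B| |A - C|\<close>, whose proof sends a pair \<open>(a, x)\<close>, with \<open>x = b - c\<close> in \<open>B - C\<close>,
  to \<open>(a - b, a - c)\<close>. For functions, put \<open>F = f \<star>\<^sub>0 reflect g\<close>, \<open>H = f \<star>\<^sub>0 reflect h\<close> and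
  \<open>G = g \<star>\<^sub>0 reflect h\<close>. By Tonelli and translation invariance, the product of the integrals of
  \<open>F\<close> and \<open>H\<close> is the integral over \<open>x\<close> of the correlation \<open>\<integral> F u * H (u + x) du\<close>. For every splitting
  \<open>x = b - c\<close>, the substitution \<open>u = a - b\<close> gives the integrand
  \<open>F (a - b) * H (a - c) \<ge> (f a)\<^sup>2 * (g b * h c)\<close>, and the supremum over all splittings shows that the
  correlation is at least \<open>G x\<close> times the integral of \<open>f\<^sup>2\<close> (\<open>asplund_correlation_ge\<close>). Hence the
  triangle inequality holds with constant \<open>1\<close> once \<open>f\<close> is replaced by \<open>f\<^sup>2\<close> in its first factor
  (\<open>asplund_triangle_square\<close>).

  The function \<open>f\<close> enters twice on the right, and this is where log-concavity and \<open>f 0 = 1\<close> are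
  used: \<open>x\<close> is the midpoint of \<open>2 x\<close> and \<open>0\<close>, so \<open>(f x)\<^sup>2 \<ge> f (2 x)\<close>, and the integral of \<open>f (2 x)\<close>
  is \<open>2\<close> to the power \<open>-n\<close> times that of \<open>f\<close>.

  Equality holds when \<open>f\<close> is \<open>exp (- (x\<^sub>1 + \<dots> + x\<^sub>n))\<close> on the nonnegative orthant, zero elsewhere, and
  \<open>g = h = reflect f\<close>. Indeed \<open>f \<star>\<^sub>0 f = f\<close> has integral \<open>1\<close>, whereas \<open>reflect f \<star>\<^sub>0 f\<close> is
  \<open>exp (- (|x\<^sub>1| + \<dots> + |x\<^sub>n|))\<close>, with one copy of \<open>f\<close> in each of the \<open>2\<close> to the power \<open>n\<close> orthants.
  So no smaller constant is possible (\<open>asplund_triangle_constant_ge\<close>).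
\<close>

section \<open>Functions in \<open>C_0\<close>\<close>

lemma C_0_nonneg: "f \<in> C_0 \<Longrightarrow> 0 \<le> f x"
  by (simp add: C_0_def)

lemma C_0_zero: "f \<in> C_0 \<Longrightarrow> f 0 = 1"
  by (simp add: C_0_def)

lemma C_0_le_1:
  assumes "f \<in> C_0"
  shows "f x \<le> 1"
proof -
  have "ennreal \<bar>f x\<bar> \<le> sup_norm f"
    unfolding sup_norm_def by (rule SUP_upper) simp
  also have "\<dots> = ennreal 1"
    using assms by (simp add: C_0_def)
  finally show ?thesis
    using ennreal_le_iff[of 1 "\<bar>f x\<bar>"] by simp
qed

lemma closed_superlevel:
  fixes f :: "'a::topological_space \<Rightarrow> real"
  assumes "upper_semicontinuous f"
  shows "closed {x. p \<le> f x}"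
proof -
  have "open {x. f x < p}"
  proof (rule Topological_Spaces.openI)
    fix x
    assume "x \<in> {x. f x < p}"
    then have "\<forall>\<^sub>F y in nhds x. f y < p"
      using assms by (simp add: upper_semicontinuous_def)
    then show "\<exists>T. open T \<and> x \<in> T \<and> T \<subseteq> {x. f x < p}"
      by (auto simp: eventually_nhds)
  qed
  moreover have "- {x. p \<le> f x} = {x. f x < p}"
    by auto
  ultimately show ?thesis
    by (simp add: closed_def)
qed

text \<open>
  Upper semicontinuity makes the superlevel set closed, decay at infinity makes it bounded. Compactness
  matters because it survives Minkowski sums, which closedness alone does not.
\<close>
lemma compact_superlevel:
  fixes f :: "'a::euclidean_space \<Rightarrow> real"
  assumes "f \<in> C_0" "0 < p"
  shows "compact {x. p \<le> f x}"
proof -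
  have "closed {x. p \<le> f x}"
    using assms(1) by (intro closed_superlevel) (simp add: C_0_def)
  moreover have "bounded {x. p \<le> f x}"
  proof -
    have "\<forall>\<^sub>F x in at_infinity. f x < p"
      using assms by (intro order_tendstoD(2)[of f 0]) (simp_all add: C_0_def)
    then obtain B where "\<And>x. B \<le> norm x \<Longrightarrow> f x < p"
      unfolding eventually_at_infinity by blast
    then have "norm x \<le> B" if "p \<le> f x" for x
      using that by (meson leI less_imp_le not_le)
    then show ?thesis
      unfolding bounded_iff by blast
  qed
  ultimately show ?thesis
    by (simp add: compact_eq_bounded_closed)
qed

lemma C_0_measurable:
  fixes f :: "'a::euclidean_space \<Rightarrow> real"
  assumes "f \<in> C_0"
  shows "f \<in> borel_measurable borel"
proof -
  have "closed {x. p \<le> f x}" for p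
    using assms by (intro closed_superlevel) (simp add: C_0_def)
  then show ?thesis
    by (simp add: borel_measurable_iff_ge)
qed

lemma reflect_in_C_0:
  fixes g :: "'a::real_normed_vector \<Rightarrow> real"
  assumes "g \<in> C_0"
  shows "reflect g \<in> C_0"
proof -
  have "upper_semicontinuous (reflect g)"
    unfolding upper_semicontinuous_def
  proof (intro allI impI)
    fix x c
    assume "reflect g x < c"
    moreover have "upper_semicontinuous g"
      using assms by (simp add: C_0_def)
    ultimately have "\<forall>\<^sub>F y in nhds (- x). g y < c"
      by (simp add: upper_semicontinuous_def reflect_def)
    then show "\<forall>\<^sub>F y in nhds x. reflect g y < c"
      unfolding reflect_def by (rule eventually_compose_filterlim[OF _ tendsto_minus[OF filterlim_ident]])
  qed
  moreover have "log_concave (reflect g)"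
    unfolding log_concave_def
  proof (intro allI impI)
    fix x y :: 'a and t :: real
    assume *: "0 < reflect g x \<and> 0 < reflect g y \<and> 0 \<le> t \<and> t \<le> 1"
    have "log_concave g"
      using assms by (simp add: C_0_def)
    then have "g (- x) powr t * g (- y) powr (1 - t) \<le> g (t *\<^sub>R (- x) + (1 - t) *\<^sub>R (- y))"
      using * unfolding log_concave_def reflect_def by blast
    then show "reflect g x powr t * reflect g y powr (1 - t) \<le> reflect g (t *\<^sub>R x + (1 - t) *\<^sub>R y)"
      by (simp add: reflect_def algebra_simps)
  qed
  moreover have "sup_norm (reflect g) = sup_norm g"
    unfolding sup_norm_def
  proof (rule SUP_eq)
    show "\<exists>y\<in>UNIV. ennreal \<bar>reflect g x\<bar> \<le> ennreal \<bar>g y\<bar>" for x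
      by (rule bexI[of _ "- x"]) (simp_all add: reflect_def)
    show "\<exists>x\<in>UNIV. ennreal \<bar>g y\<bar> \<le> ennreal \<bar>reflect g x\<bar>" for y
      by (rule bexI[of _ "- y"]) (simp_all add: reflect_def)
  qed
  moreover have "(reflect g \<longlongrightarrow> 0) at_infinity"
  proof -
    have "filterlim uminus at_infinity (at_infinity :: 'a filter)"
      unfolding filterlim_at_infinity[OF order_refl] eventually_at_infinity by auto
    then show ?thesis
      using assms unfolding reflect_def C_0_def by (auto intro: filterlim_compose)
  qed
  ultimately show ?thesis
    using assms by (simp add: C_0_def reflect_def)
qed

text \<open>
  This is log-concavity at the midpoint of \<open>2 x\<close> and \<open>0\<close>, where \<open>f 0 = 1\<close>. The dilation by \<open>2\<close> is the
  source of the factor \<open>2\<close> per dimension in the inequality.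
\<close>
lemma C_0_double_le_square:
  assumes "f \<in> C_0"
  shows "f (2 *\<^sub>R x) \<le> (f x)\<^sup>2"
proof (cases "0 < f (2 *\<^sub>R x)")
  case True
  have "log_concave f"
    using assms by (simp add: C_0_def)
  then have "f (2 *\<^sub>R x) powr (1/2) * f 0 powr (1 - 1/2) \<le> f ((1/2) *\<^sub>R (2 *\<^sub>R x) + (1 - 1/2) *\<^sub>R 0)"
    unfolding log_concave_def using True C_0_zero[OF assms]
    by (elim allE[of _ "2 *\<^sub>R x"] allE[of _ 0] allE[of _ "1/2"]) simp
  then have "sqrt (f (2 *\<^sub>R x)) \<le> f x"
    using True C_0_zero[OF assms] by (simp add: powr_half_sqrt)
  then show ?thesis
    using sqrt_le_D by blast
next
  case False
  then have "f (2 *\<^sub>R x) \<le> 0"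
    by simp
  also have "0 \<le> (f x)\<^sup>2"
    by simp
  finally show ?thesis .
qed

section \<open>The Asplund product\<close>

lemma asplund_eq: "(f \<star>\<^sub>0 g) x = (SUP y. f y * g (x - y))"
proof -
  have "{(y, z). y + z = x} = (\<lambda>y. (y, x - y)) ` UNIV"
    by (auto simp: algebra_simps)
  then show ?thesis
    by (simp add: asplund_def image_image)
qed

lemma asplund_bdd:
  assumes "f \<in> C_0" "g \<in> C_0"
  shows "bdd_above (range (\<lambda>y. f y * g (x - y)))"
proof (rule bdd_aboveI)
  fix r
  assume "r \<in> range (\<lambda>y. f y * g (x - y))"
  then show "r \<le> 1"
    using C_0_le_1[OF assms(1)] C_0_le_1[OF assms(2)] C_0_nonneg[OF assms(2)]
    by (auto intro: mult_le_one)
qed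

lemma asplund_ge:
  assumes "f \<in> C_0" "g \<in> C_0"
  shows "f y * g z \<le> (f \<star>\<^sub>0 g) (y + z)"
  unfolding asplund_eq using cSUP_upper[OF UNIV_I asplund_bdd[OF assms], of y "y + z"] by simp

lemma asplund_nonneg:
  assumes "f \<in> C_0" "g \<in> C_0"
  shows "0 \<le> (f \<star>\<^sub>0 g) x"
proof -
  have "0 \<le> f x * g 0"
    using assms by (simp add: C_0_nonneg)
  also have "\<dots> \<le> (f \<star>\<^sub>0 g) x"
    using asplund_ge[OF assms, of x 0] by simp
  finally show ?thesis .
qed

text \<open>
  Multiplication by a possibly infinite constant commutes with suprema of extended reals; this form
  of the supremum is what allows the bound for a single splitting to pass to \<open>asplund\<close>.
\<close>
lemma ennreal_asplund_le:
  assumes "f \<in> C_0" "g \<in> C_0"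
  shows "ennreal ((f \<star>\<^sub>0 g) x) \<le> (SUP y. ennreal (f y * g (x - y)))" (is "_ \<le> ?S")
proof -
  have "?S \<le> ennreal 1"
    using assms by (intro SUP_least ennreal_leI mult_le_one C_0_le_1 C_0_nonneg)
  then have "?S < top"
    by (rule le_less_trans) simp
  then obtain s where s: "0 \<le> s" "?S = ennreal s"
    by (cases ?S) auto
  have "f y * g (x - y) \<le> s" for y
  proof -
    have "ennreal (f y * g (x - y)) \<le> ennreal s"
      unfolding s(2)[symmetric] by (rule SUP_upper) simp
    then show ?thesis
      using s(1) by simp
  qed
  then have "(f \<star>\<^sub>0 g) x \<le> s"
    unfolding asplund_eq by (intro cSUP_least) simp_all
  then show ?thesis
    unfolding s(2) by (rule ennreal_leI)
qed

text \<open>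
  For \<open>d \<ge> 0\<close>, a product \<open>f y * g z\<close> exceeds \<open>d\<close> exactly when there are positive rational lower bounds \<open>p\<close> of \<open>f y\<close> and \<open>q\<close> of
  \<open>g z\<close> with \<open>p * q > d\<close>. This writes the superlevel set of an uncountable supremum as a countable
  union of Minkowski sums of superlevel sets, from which measurability follows.
\<close>
lemma asplund_superlevel:
  assumes "f \<in> C_0" "g \<in> C_0" "0 \<le> d"
  shows "{x. d < (f \<star>\<^sub>0 g) x} =
    (\<Union>(p, q) \<in> {(p, q). p \<in> \<rat> \<and> q \<in> \<rat> \<and> 0 < p \<and> 0 < q \<and> d < p * q}.
       {y + z |y z. y \<in> {y. p \<le> f y} \<and> z \<in> {z. q \<le> g z}})" (is "?L = ?R")
proof (intro subset_antisym subsetI)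
  fix x
  assume "x \<in> ?L"
  then obtain y where y: "d < f y * g (x - y)"
    unfolding asplund_eq mem_Collect_eq
    by (subst (asm) less_cSUP_iff) (auto intro: asplund_bdd assms)
  define z where "z = x - y"
  have pos: "0 < f y" "0 < g z"
    using y assms C_0_nonneg[of f y] C_0_nonneg[of g z] unfolding z_def
    by (auto simp: less_le)
  have "d / g z < f y"
    using y pos by (simp add: z_def field_simps)
  then obtain p where p: "p \<in> \<rat>" "d / g z < p" "p < f y"
    using Rats_dense_in_real by blast
  have "0 \<le> d / g z"
    using pos assms by simp
  then have "0 < p"
    using p by linarith
  have "d / p < g z"
    using p pos \<open>0 < p\<close> by (simp add: field_simps)
  then obtain q where q: "q \<in> \<rat>" "d / p < q" "q < g z"
    using Rats_dense_in_real by blast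
  have "0 \<le> d / p"
    using \<open>0 < p\<close> assms by simp
  then have "0 < q"
    using q by linarith
  have "d < p * q"
    using q \<open>0 < p\<close> by (simp add: field_simps)
  moreover have "x = y + z"
    by (simp add: z_def)
  ultimately show "x \<in> ?R"
    using p q \<open>0 < p\<close> \<open>0 < q\<close> by (force intro!: less_imp_le)
next
  fix x
  assume "x \<in> ?R"
  then obtain p q y z where "0 < p" "0 < q" "d < p * q" "p \<le> f y" "q \<le> g z" "x = y + z"
    by auto
  then have "p * q \<le> f y * g z"
    by (intro mult_mono) auto
  with \<open>d < p * q\<close> have "d < f y * g z"
    by linarith
  then show "x \<in> ?L"
    using asplund_ge[OF assms(1,2), of y z] \<open>x = y + z\<close> by simp
qed

lemma asplund_measurable:
  fixes f g :: "'a::euclidean_space \<Rightarrow> real"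
  assumes "f \<in> C_0" "g \<in> C_0"
  shows "f \<star>\<^sub>0 g \<in> borel_measurable borel"
proof -
  have "{x. d < (f \<star>\<^sub>0 g) x} \<in> sets borel" for d
  proof (cases "0 \<le> d")
    case True
    have "countable {(p, q). p \<in> \<rat> \<and> q \<in> \<rat> \<and> 0 < p \<and> 0 < q \<and> d < p * q}"
      by (rule countable_subset[of _ "\<rat> \<times> \<rat>"]) (auto intro: countable_rat)
    then show ?thesis
      unfolding asplund_superlevel[OF assms True]
    proof (rule sets.countable_UN', clarify)
      fix p q :: real
      assume "0 < p" "0 < q"
      then show "{y + z |y z. y \<in> {y. p \<le> f y} \<and> z \<in> {z. q \<le> g z}} \<in> sets borel"
        by (intro borel_compact compact_sums compact_superlevel assms)
    qed
  next
    case False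
    then have "{x. d < (f \<star>\<^sub>0 g) x} = UNIV"
      using less_le_trans[OF _ asplund_nonneg[OF assms]] by (auto simp: not_le)
    then show ?thesis
      by simp
  qed
  then show ?thesis
    unfolding borel_measurable_iff_greater by simp
qed

section \<open>The inequality\<close>

lemma nn_integral_translate:
  fixes F :: "'a::euclidean_space \<Rightarrow> ennreal"
  assumes [measurable]: "F \<in> borel_measurable borel"
  shows "(\<integral>\<^sup>+x. F (t + x) \<partial>lborel) = (\<integral>\<^sup>+x. F x \<partial>lborel)"
proof -
  have "(\<integral>\<^sup>+x. F x \<partial>lborel) = (\<integral>\<^sup>+x. F x \<partial>distr lborel borel (\<lambda>x. t + x))"
    by (simp add: lborel_distr_plus)
  also have "\<dots> = (\<integral>\<^sup>+x. F (t + x) \<partial>lborel)"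
    by (rule nn_integral_distr) simp_all
  finally show ?thesis ..
qed

lemma L1_norm_dilate:
  fixes f :: "'a::euclidean_space \<Rightarrow> real"
  assumes [measurable]: "f \<in> borel_measurable borel"
  shows "L1_norm f = 2 ^ DIM('a) * (\<integral>\<^sup>+x. ennreal (f (2 *\<^sub>R x)) \<partial>lborel)"
proof -
  have "L1_norm f = (\<integral>\<^sup>+x. ennreal (f x)
      \<partial>density (distr lborel borel (\<lambda>x. 0 + 2 *\<^sub>R x)) (\<lambda>_. ennreal (\<bar>2\<bar> ^ DIM('a))))"
    unfolding L1_norm_def by (subst lborel_affine[of 2 "0::'a"]) simp_all
  also have "\<dots> = 2 ^ DIM('a) * (\<integral>\<^sup>+x. ennreal (f (2 *\<^sub>R x)) \<partial>lborel)"
    by (simp add: nn_integral_density nn_integral_distr nn_integral_cmult flip: ennreal_power)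
  finally show ?thesis .
qed

text \<open>
  Integrate \<open>f (2 x) \<le> (f x)\<^sup>2\<close> and rescale.
\<close>
lemma L1_norm_le_square:
  fixes f :: "'a::euclidean_space \<Rightarrow> real"
  assumes "f \<in> C_0"
  shows "L1_norm f \<le> 2 ^ DIM('a) * L1_norm (\<lambda>x. (f x)\<^sup>2)"
proof -
  have "L1_norm f = 2 ^ DIM('a) * (\<integral>\<^sup>+x. ennreal (f (2 *\<^sub>R x)) \<partial>lborel)"
    using assms by (intro L1_norm_dilate C_0_measurable)
  also have "\<dots> \<le> 2 ^ DIM('a) * L1_norm (\<lambda>x. (f x)\<^sup>2)"
    unfolding L1_norm_def using assms
    by (intro mult_left_mono nn_integral_mono ennreal_leI C_0_double_le_square) simp_all
  finally show ?thesis .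
qed

text \<open>
  For a fixed splitting \<open>x = b + (x - b)\<close> the variable \<open>u\<close> is replaced by \<open>a - b\<close>. Then both factors of
  the integrand contain the same \<open>a\<close>: the first is at least \<open>f a * g b\<close>, the second at least
  \<open>f a * reflect h (x - b)\<close>. The supremum over \<open>b\<close> is taken after integration, so no measurable choice
  of a nearly optimal splitting is required.
\<close>
lemma asplund_correlation_ge:
  fixes f g h :: "'a::euclidean_space \<Rightarrow> real"
  assumes f: "f \<in> C_0" and g: "g \<in> C_0" and h: "h \<in> C_0"
  shows "L1_norm (\<lambda>x. (f x)\<^sup>2) * ennreal ((g \<star>\<^sub>0 reflect h) x)
    \<le> (\<integral>\<^sup>+u. ennreal ((f \<star>\<^sub>0 reflect g) u) * ennreal ((f \<star>\<^sub>0 reflect h) (u + x)) \<partial>lborel)"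
    (is "?N * _ \<le> ?I")
proof -
  note C = f g h reflect_in_C_0[OF g] reflect_in_C_0[OF h]
  note [measurable] = C_0_measurable[OF f] asplund_measurable[OF f C(4)] asplund_measurable[OF f C(5)]
  have "?N * ennreal (g b * reflect h (x - b)) \<le> ?I" for b
  proof -
    have "?N * ennreal (g b * reflect h (x - b)) =
        (\<integral>\<^sup>+a. ennreal ((f a)\<^sup>2) * ennreal (g b * reflect h (x - b)) \<partial>lborel)"
      unfolding L1_norm_def by (rule nn_integral_multc[symmetric]) simp
    also have "\<dots> \<le> (\<integral>\<^sup>+a. ennreal ((f \<star>\<^sub>0 reflect g) (- b + a)) *
                          ennreal ((f \<star>\<^sub>0 reflect h) (- b + a + x)) \<partial>lborel)"
    proof (rule nn_integral_mono)
      fix a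
      have "f a * g b \<le> (f \<star>\<^sub>0 reflect g) (- b + a)"
        using asplund_ge[OF f C(4), of a "- b"] by (simp add: reflect_def)
      moreover have "f a * reflect h (x - b) \<le> (f \<star>\<^sub>0 reflect h) (- b + a + x)"
        using asplund_ge[OF f C(5), of a "x - b"] by (simp add: algebra_simps)
      ultimately have "(f a * g b) * (f a * reflect h (x - b))
          \<le> (f \<star>\<^sub>0 reflect g) (- b + a) * (f \<star>\<^sub>0 reflect h) (- b + a + x)"
        using C by (intro mult_mono mult_nonneg_nonneg asplund_nonneg C_0_nonneg)
      then show "ennreal ((f a)\<^sup>2) * ennreal (g b * reflect h (x - b)) \<le>
          ennreal ((f \<star>\<^sub>0 reflect g) (- b + a)) * ennreal ((f \<star>\<^sub>0 reflect h) (- b + a + x))"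
        using C by (simp add: asplund_nonneg C_0_nonneg power2_eq_square mult_ac ennreal_leI
            flip: ennreal_mult)
    qed
    also have "\<dots> = ?I"
      by (rule nn_integral_translate) simp
    finally show ?thesis .
  qed
  then have "?N * (SUP b. ennreal (g b * reflect h (x - b))) \<le> ?I"
    unfolding SUP_mult_left_ennreal by (rule SUP_least)
  moreover have "?N * ennreal ((g \<star>\<^sub>0 reflect h) x) \<le> ?N * (SUP b. ennreal (g b * reflect h (x - b)))"
    by (intro mult_left_mono ennreal_asplund_le g C(5)) simp
  ultimately show ?thesis
    by (rule order_trans[rotated])
qed

text \<open>
  Integrating the correlation over all shifts \<open>x\<close> separates the two factors, since the inner integral
  of \<open>H (u + x)\<close> over \<open>x\<close> does not depend on \<open>u\<close>.
\<close>
lemma asplund_triangle_square: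
  fixes f g h :: "'a::euclidean_space \<Rightarrow> real"
  assumes f: "f \<in> C_0" and g: "g \<in> C_0" and h: "h \<in> C_0"
  shows "L1_norm (\<lambda>x. (f x)\<^sup>2) * L1_norm (g \<star>\<^sub>0 reflect h)
    \<le> L1_norm (f \<star>\<^sub>0 reflect g) * L1_norm (f \<star>\<^sub>0 reflect h)"
proof -
  note R = reflect_in_C_0[OF g] reflect_in_C_0[OF h]
  define F where "F = (\<lambda>u. ennreal ((f \<star>\<^sub>0 reflect g) u))"
  define H where "H = (\<lambda>u. ennreal ((f \<star>\<^sub>0 reflect h) u))"
  have [measurable]: "F \<in> borel_measurable borel" "H \<in> borel_measurable borel"
    "g \<star>\<^sub>0 reflect h \<in> borel_measurable borel"
    unfolding F_def H_def using asplund_measurable f g R by measurable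
  have "L1_norm (\<lambda>x. (f x)\<^sup>2) * L1_norm (g \<star>\<^sub>0 reflect h) =
      (\<integral>\<^sup>+x. L1_norm (\<lambda>x. (f x)\<^sup>2) * ennreal ((g \<star>\<^sub>0 reflect h) x) \<partial>lborel)"
    unfolding L1_norm_def[of "g \<star>\<^sub>0 reflect h"] by (rule nn_integral_cmult[symmetric]) simp
  also have "\<dots> \<le> (\<integral>\<^sup>+x. \<integral>\<^sup>+u. F u * H (u + x) \<partial>lborel \<partial>lborel)"
    unfolding F_def H_def using assms by (intro nn_integral_mono asplund_correlation_ge)
  also have "\<dots> = (\<integral>\<^sup>+u. \<integral>\<^sup>+x. F u * H (u + x) \<partial>lborel \<partial>lborel)"
    by (rule lborel_pair.Fubini') measurable
  \<comment> \<open>Translation invariance removes \<open>u\<close> from the inner integral.\<close>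
  also have "\<dots> = (\<integral>\<^sup>+u. F u * (\<integral>\<^sup>+x. H x \<partial>lborel) \<partial>lborel)"
    by (simp add: nn_integral_cmult nn_integral_translate)
  also have "\<dots> = (\<integral>\<^sup>+u. F u \<partial>lborel) * (\<integral>\<^sup>+x. H x \<partial>lborel)"
    by (rule nn_integral_multc) simp
  finally show ?thesis
    unfolding L1_norm_def F_def H_def .
qed

lemma asplund_triangle:
  fixes f g h :: "'a::euclidean_space \<Rightarrow> real"
  assumes "f \<in> C_0" "g \<in> C_0" "h \<in> C_0"
  shows "L1_norm f * L1_norm (g \<star>\<^sub>0 reflect h)
    \<le> 2 ^ DIM('a) * L1_norm (f \<star>\<^sub>0 reflect g) * L1_norm (f \<star>\<^sub>0 reflect h)"
proof -
  have "L1_norm f * L1_norm (g \<star>\<^sub>0 reflect h)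
      \<le> 2 ^ DIM('a) * L1_norm (\<lambda>x. (f x)\<^sup>2) * L1_norm (g \<star>\<^sub>0 reflect h)"
    using assms by (intro mult_right_mono L1_norm_le_square) simp_all
  also have "\<dots> = 2 ^ DIM('a) * (L1_norm (\<lambda>x. (f x)\<^sup>2) * L1_norm (g \<star>\<^sub>0 reflect h))"
    by (simp add: mult.assoc)
  also have "\<dots> \<le> 2 ^ DIM('a) * (L1_norm (f \<star>\<^sub>0 reflect g) * L1_norm (f \<star>\<^sub>0 reflect h))"
    using assms by (intro mult_left_mono asplund_triangle_square) simp_all
  finally show ?thesis
    by (simp add: mult.assoc)
qed

section \<open>The extremal example and sharpness\<close>

definition orthant_exp :: "'a::euclidean_space \<Rightarrow> real" where
  "orthant_exp x = (if \<forall>b\<in>Basis. 0 \<le> x \<bullet> b then exp (- (\<Sum>b\<in>Basis. x \<bullet> b)) else 0)"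

lemma orthant_exp_nonneg: "0 \<le> orthant_exp x"
  by (simp add: orthant_exp_def)

lemma orthant_exp_le: "orthant_exp x \<le> exp (- norm x)"
proof (cases "\<forall>b\<in>Basis. 0 \<le> x \<bullet> b")
  case True
  then have "norm x \<le> (\<Sum>b\<in>Basis. x \<bullet> b)"
    using norm_le_l1[of x] by simp
  then show ?thesis
    using True by (simp add: orthant_exp_def)
next
  case False
  then have "orthant_exp x = 0"
    unfolding orthant_exp_def by (rule if_not_P)
  then show ?thesis
    by simp
qed

lemma orthant_exp_log_concave: "log_concave (orthant_exp :: 'a::euclidean_space \<Rightarrow> real)"
  unfolding log_concave_def
proof (intro allI impI)
  fix x y :: 'a and t :: real
  assume *: "0 < orthant_exp x \<and> 0 < orthant_exp y \<and> 0 \<le> t \<and> t \<le> 1"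
  then have pos: "\<forall>b\<in>Basis. 0 \<le> x \<bullet> b" "\<forall>b\<in>Basis. 0 \<le> y \<bullet> b"
    unfolding orthant_exp_def by (auto split: if_splits)
  then have "\<forall>b\<in>Basis. 0 \<le> (t *\<^sub>R x + (1 - t) *\<^sub>R y) \<bullet> b"
    using * by (auto simp: inner_add_left)
  moreover have "(\<Sum>b\<in>Basis. (t *\<^sub>R x + (1 - t) *\<^sub>R y) \<bullet> b)
      = t * (\<Sum>b\<in>Basis. x \<bullet> b) + (1 - t) * (\<Sum>b\<in>Basis. y \<bullet> b)"
    by (simp add: inner_add_left sum.distrib sum_distrib_left)
  ultimately show "orthant_exp x powr t * orthant_exp y powr (1 - t)
      \<le> orthant_exp (t *\<^sub>R x + (1 - t) *\<^sub>R y)"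
    using pos by (simp add: orthant_exp_def powr_def flip: exp_add)
qed

lemma orthant_exp_upper_semicontinuous:
  "upper_semicontinuous (orthant_exp :: 'a::euclidean_space \<Rightarrow> real)"
  unfolding upper_semicontinuous_def
proof (intro allI impI)
  fix x :: 'a and c :: real
  assume less: "orthant_exp x < c"
  then have "0 < c"
    using orthant_exp_nonneg[of x] by linarith
  show "\<forall>\<^sub>F y in nhds x. orthant_exp y < c"
  proof (cases "\<forall>b\<in>Basis. 0 \<le> x \<bullet> b")
    case True
    have "((\<lambda>y. exp (- (\<Sum>b\<in>Basis. y \<bullet> b))) \<longlongrightarrow> exp (- (\<Sum>b\<in>Basis. x \<bullet> b))) (nhds x)"
      by (intro tendsto_intros filterlim_ident)
    then have "\<forall>\<^sub>F y in nhds x. exp (- (\<Sum>b\<in>Basis. y \<bullet> b)) < c"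
      by (rule order_tendstoD) (use less True in \<open>simp add: orthant_exp_def\<close>)
    then show ?thesis
      by eventually_elim (use \<open>0 < c\<close> in \<open>simp add: orthant_exp_def\<close>)
  next
    case False
    then obtain b where b: "b \<in> Basis" "x \<bullet> b < 0"
      by (auto simp: not_le)
    have "((\<lambda>y. y \<bullet> b) \<longlongrightarrow> x \<bullet> b) (nhds x)"
      by (intro tendsto_intros filterlim_ident)
    then have "\<forall>\<^sub>F y in nhds x. y \<bullet> b < 0"
      using b(2) by (rule order_tendstoD)
    then show ?thesis
      by eventually_elim (use b(1) \<open>0 < c\<close> in \<open>auto simp: orthant_exp_def\<close>)
  qed
qed

lemma orthant_exp_in_C_0: "orthant_exp \<in> C_0"
proof -
  have le: "orthant_exp x \<le> 1" for x :: 'a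
    using orthant_exp_le[of x] by (rule order_trans) simp
  have zero: "orthant_exp (0::'a) = 1"
    by (simp add: orthant_exp_def)
  have "sup_norm (orthant_exp :: 'a \<Rightarrow> real) = ennreal (orthant_exp (0::'a))"
    unfolding sup_norm_def
  proof (rule antisym)
    show "(SUP x::'a. ennreal \<bar>orthant_exp x\<bar>) \<le> ennreal (orthant_exp (0::'a))"
      by (rule SUP_least) (metis abs_of_nonneg ennreal_leI le orthant_exp_nonneg zero)
    show "ennreal (orthant_exp (0::'a)) \<le> (SUP x::'a. ennreal \<bar>orthant_exp x\<bar>)"
      by (rule SUP_upper2[of 0]) (simp_all add: orthant_exp_nonneg)
  qed
  moreover have "((orthant_exp :: 'a \<Rightarrow> real) \<longlongrightarrow> 0) at_infinity"
  proof (rule tendsto_sandwich[OF _ _ tendsto_const])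
    show "((\<lambda>x::'a. exp (- norm x)) \<longlongrightarrow> 0) at_infinity"
      by (intro filterlim_compose[OF exp_at_bot] filterlim_compose[OF filterlim_uminus_at_bot_at_top]
          filterlim_norm_at_top)
  qed (simp_all add: orthant_exp_nonneg orthant_exp_le)
  ultimately show ?thesis
    by (simp add: C_0_def orthant_exp_nonneg orthant_exp_upper_semicontinuous
        orthant_exp_log_concave zero)
qed

lemma orthant_exp_mult_le: "orthant_exp y * orthant_exp z \<le> orthant_exp (y + z)"
  by (auto simp: orthant_exp_def inner_add_left sum.distrib simp flip: exp_add)

text \<open>
  On the orthant \<open>orthant_exp\<close> is multiplicative, so every splitting into two points of the orthant
  gives the same value, and all other splittings give \<open>0\<close>.
\<close>
lemma asplund_orthant_exp: "orthant_exp \<star>\<^sub>0 orthant_exp = orthant_exp"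
proof (rule ext, rule antisym)
  fix x :: 'a
  have "orthant_exp y * orthant_exp (x - y) \<le> orthant_exp x" for y
    using orthant_exp_mult_le[of y "x - y"] by simp
  then show "(orthant_exp \<star>\<^sub>0 orthant_exp) x \<le> orthant_exp x"
    unfolding asplund_eq by (intro cSUP_least) simp_all
  show "orthant_exp x \<le> (orthant_exp \<star>\<^sub>0 orthant_exp) x"
    using asplund_ge[OF orthant_exp_in_C_0 orthant_exp_in_C_0, of x 0]
    by (simp add: C_0_zero[OF orthant_exp_in_C_0])
qed

text \<open>
  The splitting of \<open>x\<close> into its coordinatewise negative and positive parts is the witness.
\<close>
lemma asplund_reflect_orthant_exp_ge:
  "exp (- (\<Sum>b\<in>Basis. \<bar>x \<bullet> b\<bar>)) \<le> (reflect orthant_exp \<star>\<^sub>0 orthant_exp) x"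
proof -
  define y where "y = (\<Sum>b\<in>Basis. min (x \<bullet> b) 0 *\<^sub>R b)"
  define z where "z = (\<Sum>b\<in>Basis. max (x \<bullet> b) 0 *\<^sub>R b)"
  have y: "y \<bullet> b = min (x \<bullet> b) 0" and z: "z \<bullet> b = max (x \<bullet> b) 0" if "b \<in> Basis" for b
    using that by (simp_all add: y_def z_def)
  have x: "x = y + z"
    by (rule euclidean_eqI) (auto simp: inner_add_left y z)
  have "(\<Sum>b\<in>Basis. \<bar>x \<bullet> b\<bar>) = (\<Sum>b\<in>Basis. z \<bullet> b) - (\<Sum>b\<in>Basis. y \<bullet> b)"
    unfolding sum_subtractf[symmetric] by (rule sum.cong) (auto simp: y z)
  then have "exp (- (\<Sum>b\<in>Basis. \<bar>x \<bullet> b\<bar>)) = reflect orthant_exp y * orthant_exp z"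
    by (simp add: reflect_def orthant_exp_def y z sum_negf flip: exp_add)
  also have "\<dots> \<le> (reflect orthant_exp \<star>\<^sub>0 orthant_exp) (y + z)"
    by (intro asplund_ge reflect_in_C_0 orthant_exp_in_C_0)
  finally show ?thesis
    by (simp add: x)
qed

lemma nn_integral_exp_half_line:
  "(\<integral>\<^sup>+t. ennreal (exp (- t)) * indicator {0..} t \<partial>lborel) = 1"
proof -
  have "(\<integral>\<^sup>+t. ennreal (exp (- t)) * indicator {0..} t \<partial>lborel) = ennreal (0 - (- exp (- 0)))"
  proof (rule nn_integral_FTC_atLeast)
    show "((\<lambda>t::real. - exp (- t)) \<longlongrightarrow> 0) at_top"
      using filterlim_compose[OF exp_at_bot filterlim_uminus_at_bot_at_top]
      by (auto intro: tendsto_minus_cancel_left[THEN iffD1])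
  qed (auto intro!: derivative_eq_intros)
  then show ?thesis
    by simp
qed

lemma nn_integral_exp_abs: "(\<integral>\<^sup>+t. ennreal (exp (- \<bar>t\<bar>)) \<partial>lborel) = 2"
proof -
  let ?p = "\<lambda>t::real. ennreal (exp (- t)) * indicator {0..} t"
  have "(\<integral>\<^sup>+t. ennreal (exp (- \<bar>t\<bar>)) \<partial>lborel) = (\<integral>\<^sup>+t. ?p t + ?p (- t) \<partial>lborel)"
    \<comment> \<open>Both half lines contain \<open>0\<close>, so the integrands agree only almost everywhere.\<close>
  proof (rule nn_integral_cong_AE)
    show "AE t in lborel. ennreal (exp (- \<bar>t\<bar>)) = ?p t + ?p (- t)"
      using AE_lborel_singleton[of 0] by eventually_elim (auto simp: indicator_def)
  qed
  also have "\<dots> = (\<integral>\<^sup>+t. ?p t \<partial>lborel) + (\<integral>\<^sup>+t. ?p (- t) \<partial>lborel)"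
    by (rule nn_integral_add) measurable
  also have "(\<integral>\<^sup>+t. ?p (- t) \<partial>lborel) = (\<integral>\<^sup>+t. ?p t \<partial>lborel)"
    by (subst (2) nn_integral_real_affine[where c = "-1" and t = 0]) simp_all
  finally show ?thesis
    by (simp add: nn_integral_exp_half_line)
qed

lemma L1_norm_orthant_exp: "L1_norm (orthant_exp :: 'a::euclidean_space \<Rightarrow> real) = 1"
proof -
  have "ennreal (orthant_exp x) =
      (\<Prod>b\<in>Basis. ennreal (exp (- (x \<bullet> b))) * indicator {0..} (x \<bullet> b))" for x :: 'a
  proof (cases "\<forall>b\<in>Basis. 0 \<le> x \<bullet> b")
    case True
    then show ?thesis
      by (simp add: orthant_exp_def exp_sum prod_ennreal flip: sum_negf)
  next
    case False
    then have "(\<Prod>b\<in>Basis. ennreal (exp (- (x \<bullet> b))) * indicator {0..} (x \<bullet> b)) = 0"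
      by (auto intro!: prod_zero simp: indicator_def)
    moreover have "orthant_exp x = 0"
      using False unfolding orthant_exp_def by (rule if_not_P)
    ultimately show ?thesis
      by simp
  qed
  then show ?thesis
    unfolding L1_norm_def
    by (simp add: nn_integral_exp_half_line
        nn_integral_lborel_prod[where f = "\<lambda>_ t. ennreal (exp (- t)) * indicator {0..} t"])
qed

lemma L1_norm_asplund_reflect_orthant_exp:
  "2 ^ DIM('a) \<le> L1_norm (reflect orthant_exp \<star>\<^sub>0 (orthant_exp :: 'a::euclidean_space \<Rightarrow> real))"
proof -
  have "(2::ennreal) ^ DIM('a) = (\<integral>\<^sup>+x. (\<Prod>b\<in>Basis. ennreal (exp (- \<bar>x \<bullet> b\<bar>))) \<partial>(lborel :: 'a measure))"
    by (subst nn_integral_lborel_prod) (simp_all add: nn_integral_exp_abs)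
  also have "\<dots> = (\<integral>\<^sup>+x. ennreal (exp (- (\<Sum>b\<in>Basis. \<bar>x \<bullet> b\<bar>))) \<partial>(lborel :: 'a measure))"
    by (simp add: exp_sum prod_ennreal flip: sum_negf)
  also have "\<dots> \<le> L1_norm (reflect orthant_exp \<star>\<^sub>0 (orthant_exp :: 'a \<Rightarrow> real))"
    unfolding L1_norm_def by (intro nn_integral_mono ennreal_leI asplund_reflect_orthant_exp_ge)
  finally show ?thesis .
qed

text \<open>
  The test functions are \<open>f = orthant_exp\<close> and \<open>g = h = reflect f\<close>.
\<close>
lemma asplund_triangle_constant_ge:
  assumes "\<forall>f\<in>C_0. \<forall>g\<in>C_0. \<forall>h\<in>(C_0 :: ('a::euclidean_space \<Rightarrow> real) set).
    L1_norm f * L1_norm (g \<star>\<^sub>0 reflect h)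
      \<le> c * L1_norm (f \<star>\<^sub>0 reflect g) * L1_norm (f \<star>\<^sub>0 reflect h)"
  shows "2 ^ DIM('a) \<le> c"
proof -
  let ?f = "orthant_exp :: 'a \<Rightarrow> real"
  have reflect: "reflect (reflect ?f) = ?f"
    by (simp add: reflect_def fun_eq_iff)
  have "2 ^ DIM('a) \<le> L1_norm ?f * L1_norm (reflect ?f \<star>\<^sub>0 reflect (reflect ?f))"
    by (simp add: reflect L1_norm_orthant_exp L1_norm_asplund_reflect_orthant_exp)
  also have "\<dots> \<le> c * L1_norm (?f \<star>\<^sub>0 reflect (reflect ?f)) * L1_norm (?f \<star>\<^sub>0 reflect (reflect ?f))"
    using assms orthant_exp_in_C_0 reflect_in_C_0[OF orthant_exp_in_C_0] by blast
  also have "\<dots> = c"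
    by (simp add: reflect asplund_orthant_exp L1_norm_orthant_exp)
  finally show ?thesis .
qed

theorem theorem1p7:
  shows "(\<forall>f\<in>C_0. \<forall>g\<in>C_0. \<forall>h\<in>(C_0 :: (real ^ 'n \<Rightarrow> real) set).
            L1_norm f * L1_norm (g \<star>\<^sub>0 reflect h)
              \<le> 2 ^ CARD('n) * L1_norm (f \<star>\<^sub>0 reflect g) * L1_norm (f \<star>\<^sub>0 reflect h))
       \<and> (\<forall>c::ennreal. c < 2 ^ CARD('n) \<longrightarrow>
            \<not> (\<forall>f\<in>C_0. \<forall>g\<in>C_0. \<forall>h\<in>(C_0 :: (real ^ 'n \<Rightarrow> real) set).
                  L1_norm f * L1_norm (g \<star>\<^sub>0 reflect h)
                    \<le> c * L1_norm (f \<star>\<^sub>0 reflect g) * L1_norm (f \<star>\<^sub>0 reflect h)))"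
proof -
  have dim: "DIM(real ^ 'n) = CARD('n)"
    by simp
  note triangle = asplund_triangle[where 'a = "real ^ 'n", unfolded dim]
  note constant_ge = asplund_triangle_constant_ge[where 'a = "real ^ 'n", unfolded dim]
  show ?thesis
    using triangle constant_ge leD by blast
qed

end
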